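(* For $\beta>1$ let $T_\beta:[0,1)\to[0,1)$ be given by $T_\beta(x)=\beta x-\lfloor\beta x\rfloor$, where $[0,1)$ carries the usual distance $d(x,y)=|x-y|$. For Lebesgue almost every $\beta\in(1,+\infty)$ the map $T_\beta$: (i) is locally eventually onto; (ii) is (positively) expansive; (iii) does not satisfy the specification property.
   Context: The following notions are used for a (not necessarily continuous) map $f:X\to X$ of a metric space $(X,d)$, here $X=[0,1)$ and $f=T_\beta$. $\mathbb N=\{0,1,2,\dots\}$. Locally eventually onto: for every nonempty open set $U\subset X$ there is $n\in\mathbb N$ with $f^n(U)=X$. Positively expansive (called simply "expansive"): there exists $\alpha>0$ such that if $x,y\in X$ and $x\neq y$, then $d(f^n(x),f^n(y))>\alpha$ for some $n\ge 0$. Specification: for integers $b\ge a\ge 0$ let $f^{[a,b]}(x):=\{f^j(x): a\le j\le b\}$. A family of orbit segments $\{f^{[a_j,b_j]}(x_j)\}_{j=1}^n$ (with $x_j\in X$ and integers $0\le a_j\le b_j$) is an $N$-spaced specification if $a_i-b_{i-1}\ge N$ for $2\le i\le n$. It is $\varepsilon$-shadowed by $y\in X$ if $d(f^k(y),f^k(x_i))\le\varepsilon$ for all $a_i\le k\le b_i$ and $1\le i\le n$. The map $f$ has the specification property if for any $\varepsilon>0$ there is a constant $N=N(\varepsilon)$ such that any $N$-spaced specification $\{f^{[a_j,b_j]}(x_j)\}_{j=1}^n$ is $\varepsilon$-shadowed by some $y\in X$. *)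

theory Defs
  imports "HOL-Analysis.Analysis"
begin

text \<open>
  A map \<open>f : X \<rightarrow> X\<close> of a metric space is given by a subset \<open>X\<close> of a metric-space type and a
  function on that type that maps \<open>X\<close> into itself. \<open>X\<close> carries the restricted metric and the
  subspace topology; the behaviour of \<open>f\<close> outside \<open>X\<close> is irrelevant.
\<close>

definition locally_eventually_onto :: "'a::metric_space set \<Rightarrow> ('a \<Rightarrow> 'a) \<Rightarrow> bool" where
  "locally_eventually_onto X f \<longleftrightarrow>
     (\<forall>U. openin (top_of_set X) U \<and> U \<noteq> {} \<longrightarrow> (\<exists>n. (f ^^ n) ` U = X))"

definition positively_expansive :: "'a::metric_space set \<Rightarrow> ('a \<Rightarrow> 'a) \<Rightarrow> bool" where
  "positively_expansive X f \<longleftrightarrow>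
     (\<exists>\<alpha>>0. \<forall>x\<in>X. \<forall>y\<in>X. x \<noteq> y \<longrightarrow> (\<exists>n. dist ((f ^^ n) x) ((f ^^ n) y) > \<alpha>))"

text \<open>
  The orbit segments \<open>f\<^sup>k (x j)\<close>, \<open>a j \<le> k \<le> b j\<close>, for \<open>1 \<le> j \<le> n\<close>, are represented by their data
  \<open>a\<close>, \<open>b\<close>, \<open>x\<close>; values at indices outside \<open>{1..n}\<close> are irrelevant. The spacing condition
  \<open>a i - b (i - 1) \<ge> N\<close> is written additively because subtraction on \<^typ>\<open>nat\<close> truncates.
\<close>

definition spaced_specification ::
    "'a set \<Rightarrow> nat \<Rightarrow> nat \<Rightarrow> (nat \<Rightarrow> nat) \<Rightarrow> (nat \<Rightarrow> nat) \<Rightarrow> (nat \<Rightarrow> 'a) \<Rightarrow> bool" where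
  "spaced_specification X N n a b x \<longleftrightarrow>
     (\<forall>j\<in>{1..n}. x j \<in> X \<and> a j \<le> b j) \<and> (\<forall>i\<in>{2..n}. b (i - 1) + N \<le> a i)"

definition shadowed_by ::
    "('a::metric_space \<Rightarrow> 'a) \<Rightarrow> real \<Rightarrow> nat \<Rightarrow> (nat \<Rightarrow> nat) \<Rightarrow> (nat \<Rightarrow> nat) \<Rightarrow> (nat \<Rightarrow> 'a) \<Rightarrow> 'a \<Rightarrow> bool"
  where
  "shadowed_by f \<epsilon> n a b x y \<longleftrightarrow>
     (\<forall>i\<in>{1..n}. \<forall>k\<in>{a i..b i}. dist ((f ^^ k) y) ((f ^^ k) (x i)) \<le> \<epsilon>)"

definition specification_property :: "'a::metric_space set \<Rightarrow> ('a \<Rightarrow> 'a) \<Rightarrow> bool" where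
  "specification_property X f \<longleftrightarrow>
     (\<forall>\<epsilon>>0. \<exists>N. \<forall>n a b x. spaced_specification X N n a b x \<longrightarrow>
        (\<exists>y\<in>X. shadowed_by f \<epsilon> n a b x y))"

definition beta_map :: "real \<Rightarrow> real \<Rightarrow> real" where
  "beta_map \<beta> x = \<beta> * x - of_int \<lfloor>\<beta> * x\<rfloor>"

lemma beta_map_in_unit: "beta_map \<beta> x \<in> {0..<1}"
  using frac_ge_0[of "\<beta> * x"] frac_lt_1[of "\<beta> * x"] by (simp add: beta_map_def frac_def)

end

theory Submission
  imports Defs
begin

text \<open>
  Near \<open>0\<close> and away from the discontinuities \<open>m / \<beta>\<close> the map \<open>T\<close> expands by \<open>\<beta>\<close>, and close points
  separated by a discontinuity are torn apart; this gives (i) and (ii) for every \<open>\<beta> > 1\<close>.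

  For (iii), suppose that \<open>T\<^sup>n 1\<close> is never \<open>0\<close> but comes arbitrarily close to \<open>0\<close>. A point
  shadowing the first \<open>n\<close> iterates of an \<open>x\<close> slightly to the left of \<open>1\<close> has its \<open>n\<close>-th iterate in
  \<open>[0, T\<^sup>n 1)\<close>, so it needs a long time to get away from \<open>0\<close>; no bounded gap \<open>N\<close> suffices.

  The condition holds for almost every \<open>\<beta>\<close>. The zeros of \<open>\<beta> \<mapsto> T\<^sup>n 1\<close> are algebraic. If \<open>T\<^sup>n 1 \<ge> \<delta>\<close>
  for all \<open>n\<close>, follow the branch of \<open>T\<^sup>n 1\<close> (a polynomial in \<open>\<beta>\<close>) to the left until its first zero
  \<open>L\<close>. On \<open>[L, \<beta>]\<close> it is convex, so it is below \<open>\<delta>\<close> on a proportion \<open>\<delta>\<close> of this interval, whose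
  length tends to \<open>0\<close> with \<open>n\<close>. Such \<open>\<beta>\<close> are not density points of the set they form, which is
  therefore null.
\<close>

section \<open>Topological dynamics of the beta map\<close>

lemma beta_map_eqI:
  assumes "of_int m \<le> \<beta> * x" "\<beta> * x < of_int m + 1"
  shows "beta_map \<beta> x = \<beta> * x - of_int m"
  using assms by (simp add: beta_map_def floor_unique)

lemma funpow_Suc_beta_map:
  "(beta_map \<beta> ^^ Suc n) x = \<beta> * (beta_map \<beta> ^^ n) x - of_int \<lfloor>\<beta> * (beta_map \<beta> ^^ n) x\<rfloor>"
  by (simp add: beta_map_def[of _ "(beta_map \<beta> ^^ n) x"])

lemma funpow_beta_map_in_unit:
  assumes "x \<in> {0..<1}"
  shows "(beta_map \<beta> ^^ n) x \<in> {0..<1}"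
  using assms beta_map_in_unit by (cases n) (simp_all del: atLeastLessThan_iff)

lemma funpow_beta_map_linear:
  assumes "\<beta> > 1" "0 \<le> x" "\<beta> ^ n * x < 1"
  shows "(beta_map \<beta> ^^ n) x = \<beta> ^ n * x"
  using assms(3)
proof (induction n)
  case (Suc n)
  have "\<beta> ^ n * x \<le> \<beta> ^ Suc n * x"
    using assms by (intro mult_right_mono power_increasing) auto
  then have "(beta_map \<beta> ^^ n) x = \<beta> ^ n * x" using Suc by linarith
  then show ?case
    using Suc.prems assms by (simp add: beta_map_eqI[of 0] mult.assoc)
qed simp

lemma funpow_beta_map_le:
  assumes "\<beta> > 1" "0 \<le> x"
  shows "(beta_map \<beta> ^^ n) x \<le> \<beta> ^ n * x \<and> 0 \<le> (beta_map \<beta> ^^ n) x"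
proof (induction n)
  case (Suc n)
  let ?y = "(beta_map \<beta> ^^ n) x"
  have "0 \<le> \<lfloor>\<beta> * ?y\<rfloor>" using Suc assms by simp
  then have "beta_map \<beta> ?y \<le> \<beta> * ?y" by (simp add: beta_map_def)
  also have "\<dots> \<le> \<beta> * (\<beta> ^ n * x)" using Suc assms by simp
  finally show ?case using beta_map_in_unit[of \<beta> ?y] by (simp add: mult.assoc)
qed (use assms in simp)

section \<open>Covering of the unit interval by images of intervals\<close>

lemma funpow_image_covers:
  assumes "Y \<subseteq> f ` X" "\<exists>n. Z \<subseteq> (f ^^ n) ` Y"
  shows "\<exists>n. Z \<subseteq> (f ^^ n) ` X"
proof -
  obtain n where "Z \<subseteq> (f ^^ n) ` Y" using assms by blast
  then have "Z \<subseteq> (f ^^ Suc n) ` X"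
    using assms(1) by (force simp: funpow_Suc_right simp del: funpow.simps)
  then show ?thesis by blast
qed

text \<open>On a single branch the map is affine with slope \<open>\<beta>\<close>. Intervals are
  half-open like the branches, so \<open>b\<close> may be the discontinuity
  \<open>(m + 1) / \<beta>\<close> itself.\<close>

lemma beta_map_image_superset:
  assumes \<beta>: "\<beta> > 1" and "of_int m \<le> \<beta> * a" "\<beta> * b \<le> of_int m + 1"
  shows "{\<beta> * a - of_int m..<\<beta> * b - of_int m} \<subseteq> beta_map \<beta> ` {a..<b}"
proof
  fix y assume y: "y \<in> {\<beta> * a - of_int m..<\<beta> * b - of_int m}"
  define x where "x = (y + of_int m) / \<beta>"
  have x: "\<beta> * x = y + of_int m" using \<beta> by (simp add: x_def)
  then have "\<beta> * a \<le> \<beta> * x" "\<beta> * x < \<beta> * b" using y by auto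
  then have "x \<in> {a..<b}" using \<beta> by simp
  moreover have "beta_map \<beta> x = y"
    using beta_map_eqI[of m \<beta> x] x y assms by auto
  ultimately show "y \<in> beta_map \<beta> ` {a..<b}" by blast
qed

text \<open>Since 0 is a fixed point, the image of \<open>{0..<c}\<close> again starts at 0 and is
  \<open>\<beta>\<close> times as long, until it fills the unit interval. The cap at 1 in
  \<open>c'\<close> handles the last step.\<close>

lemma initial_interval_covers:
  assumes \<beta>: "\<beta> > 1" and "\<beta> ^ k * c \<ge> 1" "0 < c"
  shows "\<exists>n. {0..<1} \<subseteq> (beta_map \<beta> ^^ n) ` {0..<c}"
  using assms(2,3)
proof (induction k arbitrary: c)
  case 0
  then have "{0..<1} \<subseteq> (beta_map \<beta> ^^ 0) ` {0..<c}" by auto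
  then show ?case by blast
next
  case (Suc k)
  define c' where "c' = min (\<beta> * c) 1"
  have c': "0 < c'" "c' / \<beta> \<le> c" using \<beta> Suc by (auto simp: c'_def field_simps)
  have "{0..<c'} \<subseteq> beta_map \<beta> ` {0..<c' / \<beta>}"
    using beta_map_image_superset[of \<beta> 0 0 "c' / \<beta>"] \<beta> by (simp add: c'_def)
  also have "\<dots> \<subseteq> beta_map \<beta> ` {0..<c}" using c' by auto
  finally have sub: "{0..<c'} \<subseteq> beta_map \<beta> ` {0..<c}" .
  have "1 \<le> \<beta> ^ k * c'"
  proof (cases "\<beta> * c \<le> 1")
    case True
    then show ?thesis using Suc.prems by (simp add: c'_def mult.assoc mult.left_commute)
  next
    case False
    then show ?thesis using \<beta> by (simp add: c'_def one_le_power)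
  qed
  then show ?case using funpow_image_covers[OF sub Suc.IH] c' by simp
qed

text \<open>An interval inside one branch is stretched by \<open>\<beta>\<close>, which cannot go on
  forever within length 1. Once the left end of a branch lies in the interval, the image contains an
  interval starting at 0 and the previous lemma takes over.\<close>

lemma interval_covers:
  assumes \<beta>: "\<beta> > 1" and "\<beta> ^ k * (b - a) > 1" "0 \<le> a" "a < b" "b \<le> 1"
  shows "\<exists>n. {0..<1} \<subseteq> (beta_map \<beta> ^^ n) ` {a..<b}"
  using assms(2-)
proof (induction k arbitrary: a b)
  case 0
  then show ?case by simp
next
  case (Suc k)
  show ?case
  proof (cases "of_int \<lceil>\<beta> * a\<rceil> < \<beta> * b")
    case True
    \<comment> \<open>Here \<open>m / \<beta>\<close> is the left end of a branch and lies in
      \<open>{a..<b}\<close>. Capping \<open>c\<close> at 1 keeps \<open>{m / \<beta>..<e}\<close>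
      inside that branch.\<close>
    define m where "m = \<lceil>\<beta> * a\<rceil>"
    define c where "c = min (\<beta> * b - of_int m) 1"
    define e where "e = (c + of_int m) / \<beta>"
    have c: "c > 0" using True by (simp add: c_def m_def)
    have e: "\<beta> * e = c + of_int m" using \<beta> by (simp add: e_def)
    have "\<beta> * e \<le> \<beta> * b" using e by (simp add: c_def)
    then have "e \<le> b" using \<beta> by simp
    moreover have "a \<le> of_int m / \<beta>"
      using \<beta> by (simp add: m_def field_simps)
    ultimately have "{of_int m / \<beta>..<e} \<subseteq> {a..<b}" by auto
    moreover have "{0..<c} \<subseteq> beta_map \<beta> ` {of_int m / \<beta>..<e}"
      using beta_map_image_superset[of \<beta> m "of_int m / \<beta>" e] \<beta> e by (simp add: c_def)
    ultimately have sub: "{0..<c} \<subseteq> beta_map \<beta> ` {a..<b}" by blast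
    obtain j where "1 / c < \<beta> ^ j" using real_arch_pow[OF \<beta>] by blast
    then have "\<beta> ^ j * c \<ge> 1" using c by (simp add: field_simps)
    then show ?thesis
      using funpow_image_covers[OF sub initial_interval_covers[OF \<beta> _ c]] by simp
  next
    case False
    \<comment> \<open>No left end of a branch lies in \<open>{a..<b}\<close>. In particular
      \<open>\<beta> * a\<close> is not an integer, and the whole interval belongs to branch
      \<open>m\<close>.\<close>
    define m where "m = \<lceil>\<beta> * a\<rceil> - 1"
    have m: "of_int m < \<beta> * a" "\<beta> * b \<le> of_int m + 1"
      using False by (simp_all add: m_def) linarith
    have sub: "{\<beta> * a - of_int m..<\<beta> * b - of_int m} \<subseteq> beta_map \<beta> ` {a..<b}"
      using beta_map_image_superset[of \<beta> m a b] \<beta> m by simp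
    have "\<beta> ^ k * ((\<beta> * b - of_int m) - (\<beta> * a - of_int m)) > 1"
      using Suc.prems by (simp add: algebra_simps)
    moreover have "\<beta> * a < \<beta> * b" using Suc.prems \<beta> by simp
    ultimately show ?thesis
      using Suc.IH[of "\<beta> * b - of_int m" "\<beta> * a - of_int m"] m
      by (intro funpow_image_covers[OF sub]) simp
  qed
qed

lemma beta_map_locally_eventually_onto:
  assumes \<beta>: "\<beta> > 1"
  shows "locally_eventually_onto {0..<1} (beta_map \<beta>)"
  unfolding locally_eventually_onto_def
proof (intro allI impI, elim conjE)
  fix U :: "real set"
  assume U: "openin (top_of_set {0..<1}) U" "U \<noteq> {}"
  then obtain x where x: "x \<in> U" by blast
  obtain e where e: "e > 0" and ball: "ball x e \<inter> {0..<1} \<subseteq> U"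
    using openin_contains_ball[THEN iffD1, OF U(1)] x by meson
  have sub: "U \<subseteq> {0..<1}" using U(1) openin_imp_subset by blast
  define b where "b = min 1 (x + e)"
  have b: "0 \<le> x" "x < b" "b \<le> 1" using x sub e by (auto simp: b_def)
  have "{x..<b} \<subseteq> U"
    using ball b by (auto simp: b_def dist_real_def intro!: subsetD[OF ball])
  obtain k where "1 / (b - x) < \<beta> ^ k" using real_arch_pow[OF \<beta>] by blast
  then have "\<beta> ^ k * (b - x) > 1" using b by (simp add: field_simps)
  then obtain n where "{0..<1} \<subseteq> (beta_map \<beta> ^^ n) ` {x..<b}"
    using interval_covers[OF \<beta>] b by blast
  then have "{0..<1} \<subseteq> (beta_map \<beta> ^^ n) ` U" using \<open>{x..<b} \<subseteq> U\<close> by blast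
  moreover have "(beta_map \<beta> ^^ n) ` U \<subseteq> {0..<1}"
    using funpow_beta_map_in_unit sub by blast
  ultimately show "\<exists>n. (beta_map \<beta> ^^ n) ` U = {0..<1}" by blast
qed

section \<open>Expansivity\<close>

text \<open>The integer parts of \<open>\<beta> * x\<close> and \<open>\<beta> * y\<close> differ by
  an integer of modulus at most \<open>\<alpha> * (1 + \<beta>) < 1\<close>, hence by 0: points that
  are close before and after one step lie on the same branch.\<close>

lemma beta_map_diff:
  assumes \<beta>: "\<beta> > 1" and \<alpha>: "\<alpha> * (1 + \<beta>) < 1"
    and "\<bar>x - y\<bar> \<le> \<alpha>" "\<bar>beta_map \<beta> x - beta_map \<beta> y\<bar> \<le> \<alpha>"
  shows "beta_map \<beta> x - beta_map \<beta> y = \<beta> * (x - y)"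
proof -
  define m where "m = \<lfloor>\<beta> * x\<rfloor> - \<lfloor>\<beta> * y\<rfloor>"
  have eq: "beta_map \<beta> x - beta_map \<beta> y = \<beta> * (x - y) - of_int m"
    by (simp add: beta_map_def m_def algebra_simps)
  have "\<bar>\<beta> * (x - y)\<bar> \<le> \<beta> * \<alpha>"
    using assms by (simp add: abs_mult)
  then have "\<bar>of_int m :: real\<bar> \<le> \<beta> * \<alpha> + \<alpha>"
    using eq assms(4) by linarith
  also have "\<dots> < 1" using \<alpha> by (simp add: algebra_simps)
  finally have "m = 0" by linarith
  then show ?thesis using eq by simp
qed

text \<open>The exponential growth of the distance yields expansivity. The exact formula also
  locates a shadowing point in the refutation of specification.\<close>

lemma funpow_beta_map_diff:
  assumes "\<beta> > 1" "\<alpha> * (1 + \<beta>) < 1"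
    and "\<And>k. k \<le> n \<Longrightarrow> \<bar>(beta_map \<beta> ^^ k) x - (beta_map \<beta> ^^ k) y\<bar> \<le> \<alpha>"
  shows "(beta_map \<beta> ^^ n) x - (beta_map \<beta> ^^ n) y = \<beta> ^ n * (x - y)"
  using assms(3)
proof (induction n)
  case (Suc n)
  have "(beta_map \<beta> ^^ Suc n) x - (beta_map \<beta> ^^ Suc n) y =
      \<beta> * ((beta_map \<beta> ^^ n) x - (beta_map \<beta> ^^ n) y)"
    using beta_map_diff[OF assms(1,2)] Suc.prems[of n] Suc.prems[of "Suc n"] by simp
  then show ?case using Suc by (simp add: mult.assoc)
qed simp

lemma beta_map_positively_expansive:
  assumes \<beta>: "\<beta> > 1"
  shows "positively_expansive {0..<1} (beta_map \<beta>)"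
  unfolding positively_expansive_def
\<comment> \<open>Half of \<open>1 / (1 + \<beta>)\<close>, so that the strict bound required by
  \<open>beta_map_diff\<close> holds.\<close>
proof (intro exI[of _ "1 / (2 * (1 + \<beta>))"] conjI ballI impI)
  show "0 < 1 / (2 * (1 + \<beta>))" using \<beta> by simp
  fix x y :: real
  assume ne: "x \<noteq> y"
  define \<alpha> where "\<alpha> = 1 / (2 * (1 + \<beta>))"
  have \<alpha>: "\<alpha> * (1 + \<beta>) < 1" using \<beta> by (simp add: \<alpha>_def)
  show "\<exists>n. 1 / (2 * (1 + \<beta>)) < dist ((beta_map \<beta> ^^ n) x) ((beta_map \<beta> ^^ n) y)"
  proof (rule ccontr)
    assume "\<not> ?thesis"
    then have le: "\<bar>(beta_map \<beta> ^^ n) x - (beta_map \<beta> ^^ n) y\<bar> \<le> \<alpha>" for n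
      by (simp add: \<alpha>_def dist_real_def not_less)
    obtain k where k: "\<alpha> / \<bar>x - y\<bar> < \<beta> ^ k" using real_arch_pow[OF \<beta>] by blast
    have "(beta_map \<beta> ^^ k) x - (beta_map \<beta> ^^ k) y = \<beta> ^ k * (x - y)"
      using funpow_beta_map_diff[OF \<beta> \<alpha>] le by blast
    then have "\<beta> ^ k * \<bar>x - y\<bar> \<le> \<alpha>" using le[of k] \<beta> by (simp add: abs_mult)
    then show False using k ne by (simp add: field_simps)
  qed
qed

section \<open>Failure of specification\<close>

text \<open>The orbit of \<open>1 - s\<close> lies to the left of the orbit of 1 by
  \<open>\<beta> ^ k * s\<close>. No discontinuity is crossed as long as this gap does not exceed
  the \<open>k\<close>-th iterate of 1, which is the room left on the image side.\<close>

lemma funpow_beta_map_near_one: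
  assumes \<beta>: "\<beta> > 1" and "0 \<le> s"
    and "\<And>k. k \<le> n \<Longrightarrow> \<beta> ^ k * s \<le> (beta_map \<beta> ^^ k) 1"
  shows "(beta_map \<beta> ^^ n) (1 - s) = (beta_map \<beta> ^^ n) 1 - \<beta> ^ n * s"
  using assms(3)
proof (induction n)
  case (Suc n)
  let ?d = "(beta_map \<beta> ^^ n) 1"
  have d: "beta_map \<beta> ?d = \<beta> * ?d - of_int \<lfloor>\<beta> * ?d\<rfloor>" by (simp add: beta_map_def)
  have "beta_map \<beta> (?d - \<beta> ^ n * s) = \<beta> * (?d - \<beta> ^ n * s) - of_int \<lfloor>\<beta> * ?d\<rfloor>"
  proof (rule beta_map_eqI)
    show "of_int \<lfloor>\<beta> * ?d\<rfloor> \<le> \<beta> * (?d - \<beta> ^ n * s)"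
      using Suc.prems[of "Suc n"] d by (simp add: algebra_simps)
    have "0 \<le> \<beta> * (\<beta> ^ n * s)" using assms by simp
    then show "\<beta> * (?d - \<beta> ^ n * s) < of_int \<lfloor>\<beta> * ?d\<rfloor> + 1"
      using d beta_map_in_unit[of \<beta> ?d] by (simp add: algebra_simps)
  qed
  moreover have "(beta_map \<beta> ^^ n) (1 - s) = ?d - \<beta> ^ n * s" using Suc by simp
  ultimately show ?case using d by (simp add: right_diff_distrib mult.assoc)
qed simp

lemma beta_map_not_specification:
  assumes \<beta>: "\<beta> > 1"
    and pos: "\<And>n. (beta_map \<beta> ^^ n) 1 > 0"
    and small: "\<And>\<delta>. \<delta> > 0 \<Longrightarrow> \<exists>n. (beta_map \<beta> ^^ n) 1 < \<delta>"
  shows "\<not> specification_property {0..<1} (beta_map \<beta>)"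
proof
  define \<alpha> where "\<alpha> = 1 / (2 * (1 + \<beta>))"
  have \<alpha>: "\<alpha> > 0" "\<alpha> * (1 + \<beta>) < 1" "\<alpha> \<le> 1 / 4"
    using \<beta> by (auto simp: \<alpha>_def field_simps)
  assume "specification_property {0..<1} (beta_map \<beta>)"
  then obtain N where N: "\<And>n a b x. spaced_specification {0..<1} N n a b x \<Longrightarrow>
      \<exists>y\<in>{0..<1}. shadowed_by (beta_map \<beta>) \<alpha> n a b x y"
    using \<alpha>(1) unfolding specification_property_def by meson
  \<comment> \<open>A point starting below this bound is still below 1/4 after \<open>N\<close>
    further steps.\<close>
  obtain n where n: "(beta_map \<beta> ^^ n) 1 < 1 / (4 * \<beta> ^ N)"
    using small[of "1 / (4 * \<beta> ^ N)"] \<beta> by auto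
  \<comment> \<open>The largest \<open>s\<close> for which \<open>1 - s\<close> uses the same
    branches as 1 up to time \<open>n\<close>. It is positive because only finitely many iterates,
    none of them 0, are involved.\<close>
  define s where "s = Min ((\<lambda>k. (beta_map \<beta> ^^ k) 1 / \<beta> ^ k) ` {..n})"
  have s_le: "s \<le> (beta_map \<beta> ^^ k) 1 / \<beta> ^ k" if "k \<le> n" for k
    unfolding s_def using that by (intro Min_le) auto
  have "s > 0" unfolding s_def using pos \<beta> by (subst Min_gr_iff) auto
  have "s \<le> 1" using s_le[of 0] by simp
  have s: "\<beta> ^ k * s \<le> (beta_map \<beta> ^^ k) 1" if "k \<le> n" for k
    using s_le[OF that] \<beta> by (simp add: field_simps)
  \<comment> \<open>The orbit of \<open>z\<close> grows linearly and is exactly 1/2 at time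
    \<open>n + N\<close>.\<close>
  define z where "z = 1 / (2 * \<beta> ^ (n + N))"
  have "1 \<le> \<beta> ^ (n + N)" using \<beta> by (intro one_le_power) simp
  then have "1 < 2 * \<beta> ^ (n + N)" by linarith
  then have z: "0 \<le> z" "z < 1" "\<beta> ^ (n + N) * z = 1 / 2"
    unfolding z_def by (auto simp: field_simps simp del: power_eq_0_iff one_le_power)
  \<comment> \<open>Follow \<open>1 - s\<close> during \<open>{0..n}\<close>, then \<open>z\<close>
    at the single time \<open>n + N\<close>; the gap is exactly \<open>N\<close>.\<close>
  define a b :: "nat \<Rightarrow> nat" and x :: "nat \<Rightarrow> real"
    where "a = (\<lambda>i. if i = 1 then 0 else n + N)"
      and "b = (\<lambda>i. if i = 1 then n else n + N)"
      and "x = (\<lambda>i. if i = 1 then 1 - s else z)"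
  have "spaced_specification {0..<1} N 2 a b x"
    using z \<open>s > 0\<close> \<open>s \<le> 1\<close> by (auto simp: spaced_specification_def a_def b_def x_def)
  then obtain y where y: "0 \<le> y" "y < 1" and sh: "shadowed_by (beta_map \<beta>) \<alpha> 2 a b x y"
    using N by fastforce
  have sh1: "\<bar>(beta_map \<beta> ^^ k) (1 - s) - (beta_map \<beta> ^^ k) y\<bar> \<le> \<alpha>" if "k \<le> n" for k
    using sh[unfolded shadowed_by_def, rule_format, of 1 k] that
    by (simp add: a_def b_def x_def dist_real_def abs_minus_commute)
  have sh2: "\<bar>(beta_map \<beta> ^^ (n + N)) y - (beta_map \<beta> ^^ (n + N)) z\<bar> \<le> \<alpha>"
    using sh[unfolded shadowed_by_def, rule_format, of 2 "n + N"]
    by (simp add: a_def b_def x_def dist_real_def)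
  \<comment> \<open>Shadowing forces \<open>y\<close> onto the branches of \<open>1 - s\<close>,
    hence of 1. As \<open>y < 1\<close>, its \<open>n\<close>-th iterate cannot exceed that of
    1.\<close>
  have "(beta_map \<beta> ^^ n) y = (beta_map \<beta> ^^ n) 1 - \<beta> ^ n * (1 - y)"
    using funpow_beta_map_diff[OF \<beta> \<alpha>(2) sh1] funpow_beta_map_near_one[OF \<beta> _ s] \<open>s > 0\<close>
    by (simp add: algebra_simps)
  moreover have "\<beta> ^ n * (1 - y) \<ge> 0" using \<beta> y by simp
  ultimately have yn: "(beta_map \<beta> ^^ n) y < 1 / (4 * \<beta> ^ N)" using n by linarith
  have "(beta_map \<beta> ^^ (n + N)) y = (beta_map \<beta> ^^ N) ((beta_map \<beta> ^^ n) y)"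
    by (simp add: funpow_add add.commute[of n N])
  also have "\<dots> \<le> \<beta> ^ N * (beta_map \<beta> ^^ n) y"
    using funpow_beta_map_le \<beta> y by blast
  also have "\<dots> < 1 / 4" using yn \<beta> by (simp add: field_simps)
  finally have "(beta_map \<beta> ^^ (n + N)) y < 1 / 4" .
  moreover have "(beta_map \<beta> ^^ (n + N)) z = 1 / 2"
    using funpow_beta_map_linear[OF \<beta> z(1), of "n + N"] z(3) by simp
  ultimately show False using sh2 \<alpha>(3) by linarith
qed

section \<open>The orbit of 1 for almost every parameter\<close>

text \<open>Each step multiplies by \<open>\<beta>\<close> and subtracts a digit, which prepends a
  constant coefficient and keeps the polynomial nonzero. The digits depend on
  \<open>\<beta>\<close>, but integer lists leave only countably many polynomials.\<close>

lemma funpow_beta_map_one_poly: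
  "\<exists>as :: int list. Poly (map of_int as) \<noteq> (0 :: real poly) \<and>
     (beta_map \<beta> ^^ n) 1 = poly (Poly (map of_int as)) \<beta>"
proof (induction n)
  case 0
  show ?case by (intro exI[of _ "[1]"]) simp
next
  case (Suc n)
  then obtain as :: "int list" where as: "Poly (map of_int as) \<noteq> (0 :: real poly)"
    "(beta_map \<beta> ^^ n) 1 = poly (Poly (map of_int as)) \<beta>" by blast
  show ?case
    using as by (intro exI[of _ "- \<lfloor>\<beta> * (beta_map \<beta> ^^ n) 1\<rfloor> # as"])
       (simp add: funpow_Suc_beta_map del: funpow.simps)
qed

lemma countable_zeros_orbit_one:
  "countable {\<beta>. \<exists>n. (beta_map \<beta> ^^ n) 1 = 0}"
proof (rule countable_subset)
  let ?P = "\<lambda>as :: int list. Poly (map of_int as) :: real poly"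
  show "countable (\<Union>as\<in>{as. ?P as \<noteq> 0}. {t. poly (?P as) t = 0})"
    by (intro countable_UN) (auto intro: countable_finite poly_roots_finite)
  show "{\<beta>. \<exists>n. (beta_map \<beta> ^^ n) 1 = 0} \<subseteq> (\<Union>as\<in>{as. ?P as \<noteq> 0}. {t. poly (?P as) t = 0})"
  proof
    fix \<beta> assume "\<beta> \<in> {\<beta>. \<exists>n. (beta_map \<beta> ^^ n) 1 = 0}"
    then obtain n where "(beta_map \<beta> ^^ n) 1 = 0" by blast
    then show "\<beta> \<in> (\<Union>as\<in>{as. ?P as \<noteq> 0}. {t. poly (?P as) t = 0})"
      using funpow_beta_map_one_poly[where n = n and \<beta> = \<beta>] by auto
  qed
qed

text \<open>
  The polynomial branch of \<open>t \<mapsto> T\<^sub>t\<^sup>n 1\<close> through \<open>\<beta>\<close>, with the digits of the expansion of 1 in base \<open>\<beta>\<close>.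
\<close>

primrec branch :: "real \<Rightarrow> nat \<Rightarrow> real \<Rightarrow> real" where
  "branch \<beta> 0 t = 1"
| "branch \<beta> (Suc n) t = t * branch \<beta> n t - of_int \<lfloor>\<beta> * (beta_map \<beta> ^^ n) 1\<rfloor>"

lemma branch_self: "branch \<beta> n \<beta> = (beta_map \<beta> ^^ n) 1"
  by (induction n) (simp_all add: funpow_Suc_beta_map del: funpow.simps(2))

lemma continuous_on_branch: "continuous_on A (branch \<beta> n)"
  by (induction n) (auto intro!: continuous_intros)

lemma digit_nonneg:
  assumes "\<beta> > 1"
  shows "0 \<le> real_of_int \<lfloor>\<beta> * (beta_map \<beta> ^^ n) 1\<rfloor>"
  using funpow_beta_map_le[of \<beta> 1 n] assms by simp

text \<open>The first digit is at least 1 and later digits only subtract. Together with positivity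
  at \<open>\<beta>\<close> this provides a zero of the branch in
  \<open>{1..\<beta>}\<close>.\<close>

lemma branch_at_1:
  assumes "\<beta> > 1"
  shows "branch \<beta> (Suc n) 1 \<le> 0"
proof (induction n)
  case 0
  have "1 \<le> \<lfloor>\<beta>\<rfloor>" using assms by simp
  then show ?case by simp
next
  case (Suc n)
  have "branch \<beta> (Suc (Suc n)) 1 = branch \<beta> (Suc n) 1 - of_int \<lfloor>\<beta> * (beta_map \<beta> ^^ Suc n) 1\<rfloor>"
    by (simp only: branch.simps(2)[of _ "Suc n"] mult_1)
  then show ?case using Suc digit_nonneg[OF assms, of "Suc n"] by linarith
qed

text \<open>Reading the recursion backwards, \<open>t\<close> times a branch is the next branch plus
  a nonnegative digit. So the sign of the last branch controls all earlier ones.\<close>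

lemma branch_nonneg_antimono:
  assumes "\<beta> > 1" "1 \<le> t" "0 \<le> branch \<beta> n t" "k \<le> n"
  shows "0 \<le> branch \<beta> k t"
  using assms(4,3)
proof (induction rule: dec_induct)
  case (step m)
  have "t * branch \<beta> m t = branch \<beta> (Suc m) t + of_int \<lfloor>\<beta> * (beta_map \<beta> ^^ m) 1\<rfloor>" by simp
  then have "0 \<le> t * branch \<beta> m t"
    using step.prems digit_nonneg[OF assms(1), of m] by linarith
  then have "0 \<le> branch \<beta> m t" using assms(2) by (simp add: zero_le_mult_iff)
  then show ?case using step.IH by blast
qed

lemma branch_mono:
  assumes "1 \<le> s" "s \<le> t" "\<And>k. k \<le> n \<Longrightarrow> 0 \<le> branch \<beta> k s"
  shows "branch \<beta> n s \<le> branch \<beta> n t"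
  using assms(3)
proof (induction n)
  case (Suc n)
  then have "s * branch \<beta> n s \<le> t * branch \<beta> n t"
    using assms(1,2) by (intro mult_mono) (auto intro: order_trans)
  then show ?case by simp
qed simp

text \<open>The difference obeys a product rule whose second term,
  \<open>(\<beta> - s) * branch \<beta> (Suc n) s\<close>, is nonnegative. The exponent is one less
  than the index because the first branch has slope 1.\<close>

lemma branch_expand:
  assumes "1 \<le> s" "s \<le> \<beta>" "\<And>k. k \<le> Suc n \<Longrightarrow> 0 \<le> branch \<beta> k s"
  shows "\<beta> ^ n * (\<beta> - s) \<le> branch \<beta> (Suc n) \<beta> - branch \<beta> (Suc n) s"
  using assms(3)
proof (induction n)
  case (Suc n)
  have "\<beta> ^ Suc n * (\<beta> - s) \<le> \<beta> * (branch \<beta> (Suc n) \<beta> - branch \<beta> (Suc n) s)"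
    using Suc assms(1,2) by (simp del: branch.simps add: mult.assoc)
  also have "\<dots> \<le> \<beta> * (branch \<beta> (Suc n) \<beta> - branch \<beta> (Suc n) s) + (\<beta> - s) * branch \<beta> (Suc n) s"
    using Suc.prems[of "Suc n"] assms(2) by simp
  also have "\<dots> = branch \<beta> (Suc (Suc n)) \<beta> - branch \<beta> (Suc (Suc n)) s"
    unfolding branch.simps(2)[of \<beta> "Suc n"] by (simp only: algebra_simps)
  finally show ?case .
qed simp

text \<open>Multiplication by \<open>t\<close> preserves this chord inequality for nonnegative
  increasing functions: the defect is \<open>u * (1 - u) * (\<beta> - L) * (q - p)\<close>, which is
  nonnegative by monotonicity.\<close>

lemma branch_convex:
  assumes "1 \<le> L" "L \<le> \<beta>" "\<And>k. k \<le> n \<Longrightarrow> 0 \<le> branch \<beta> k L" "0 \<le> u" "u \<le> 1"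
  shows "branch \<beta> n ((1 - u) * L + u * \<beta>) \<le> (1 - u) * branch \<beta> n L + u * branch \<beta> n \<beta>"
  using assms(3)
proof (induction n)
  case (Suc n)
  define x where "x = (1 - u) * L + u * \<beta>"
  define p q where "p = branch \<beta> n L" and "q = branch \<beta> n \<beta>"
  have "p \<le> q" unfolding p_def q_def using branch_mono[OF assms(1,2)] Suc.prems by simp
  have "0 \<le> (1 - u) * L + u * \<beta>" using assms by simp
  then have "x * branch \<beta> n x \<le> x * ((1 - u) * p + u * q)"
    using Suc unfolding x_def p_def q_def by (intro mult_left_mono) simp_all
  also have "\<dots> = (1 - u) * (L * p) + u * (\<beta> * q) - u * (1 - u) * (\<beta> - L) * (q - p)"
    by (simp add: x_def algebra_simps)
  also have "\<dots> \<le> (1 - u) * (L * p) + u * (\<beta> * q)"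
    using assms \<open>p \<le> q\<close> by simp
  finally show ?case by (simp add: x_def p_def q_def algebra_simps)
qed simp

text \<open>Monotonicity carries the bound \<open>< 1\<close> from \<open>\<beta>\<close> down to
  \<open>t\<close>. Branch values in the unit interval mean that \<open>t\<close> and
  \<open>\<beta>\<close> share their digits.\<close>

lemma funpow_beta_map_eq_branch:
  assumes "\<beta> > 1" "1 \<le> t" "t \<le> \<beta>" "\<And>k. k \<le> n \<Longrightarrow> 0 \<le> branch \<beta> k t"
  shows "(beta_map t ^^ n) 1 = branch \<beta> n t"
  using assms(4)
proof (induction n)
  case (Suc n)
  have "branch \<beta> (Suc n) t \<le> branch \<beta> (Suc n) \<beta>"
    using branch_mono[OF assms(2,3), of "Suc n"] Suc.prems by blast
  also have "\<dots> < 1"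
    using beta_map_in_unit[of \<beta>] branch_self[of \<beta> "Suc n"] by simp
  finally have "branch \<beta> (Suc n) t < 1" .
  moreover have "0 \<le> branch \<beta> (Suc n) t" using Suc.prems by blast
  ultimately show ?case
    using Suc beta_map_eqI[of "\<lfloor>\<beta> * (beta_map \<beta> ^^ n) 1\<rfloor>" t "branch \<beta> n t"] by simp
qed simp

lemma small_orbit_one_left_of:
  assumes \<beta>: "\<beta> > 1" and pos: "0 < (beta_map \<beta> ^^ Suc n) 1"
  obtains L where "1 \<le> L" "L < \<beta>" "\<beta> ^ n * (\<beta> - L) < 1"
    "\<And>u. 0 \<le> u \<Longrightarrow> u \<le> 1 \<Longrightarrow> (beta_map ((1 - u) * L + u * \<beta>) ^^ Suc n) 1 \<le> u"
proof -
  let ?f = "branch \<beta> (Suc n)"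
  \<comment> \<open>Compactness of the zero set gives a largest zero \<open>L\<close>; by the
    intermediate value theorem the branch cannot be negative to the right of it.\<close>
  define Z where "Z = {t \<in> {1..\<beta>}. ?f t = 0}"
  have f_pos: "0 < ?f \<beta>" using pos branch_self by metis
  have "\<exists>t\<ge>1. t \<le> \<beta> \<and> ?f t = 0"
    by (rule IVT') (use f_pos branch_at_1[OF \<beta>] \<beta> continuous_on_branch in \<open>auto simp del: branch.simps\<close>)
  then have "Z \<noteq> {}" by (auto simp: Z_def simp del: branch.simps)
  moreover have "closed Z"
    unfolding Z_def
    by (intro continuous_closed_preimage_constant continuous_on_branch closed_atLeastAtMost)
  then have "compact Z"
    by (rule compact_eq_bounded_closed[THEN iffD2, OF conjI, rotated])
       (auto simp: Z_def intro: bounded_subset[of "{1..\<beta>}"])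
  ultimately obtain L where L: "L \<in> Z" and max: "\<And>t. t \<in> Z \<Longrightarrow> t \<le> L"
    using compact_attains_sup by metis
  have L1: "1 \<le> L" "L \<le> \<beta>" and fL: "?f L = 0" using L by (auto simp: Z_def simp del: branch.simps)
  have "L < \<beta>" using L1 fL f_pos by (cases "L = \<beta>") auto
  have f_nonneg: "0 \<le> ?f t" if t: "L \<le> t" "t \<le> \<beta>" for t
  proof (rule ccontr)
    assume neg: "\<not> 0 \<le> ?f t"
    have "\<exists>r\<ge>t. r \<le> \<beta> \<and> ?f r = 0"
      by (rule IVT') (use f_pos neg t continuous_on_branch in \<open>auto simp del: branch.simps\<close>)
    then obtain r where r: "t \<le> r" "r \<le> \<beta>" "?f r = 0" by blast
    then have "r \<in> Z" using t L1 by (simp add: Z_def del: branch.simps)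
    then have "t = L" using max r t by fastforce
    then show False using neg fL by simp
  qed
  have nonneg: "0 \<le> branch \<beta> k t" if "L \<le> t" "t \<le> \<beta>" "k \<le> Suc n" for k t
    using branch_nonneg_antimono[OF \<beta> _ f_nonneg] that L1 by simp
  have lt1: "?f \<beta> < 1" using branch_self[of \<beta> "Suc n"] beta_map_in_unit[of \<beta>] by simp
  show thesis
  proof (rule that[OF L1(1) \<open>L < \<beta>\<close>])
    have "\<beta> ^ n * (\<beta> - L) \<le> ?f \<beta> - ?f L"
      by (rule branch_expand) (use L1 nonneg in auto)
    then show "\<beta> ^ n * (\<beta> - L) < 1" using lt1 fL by simp
  next
    fix u :: real assume u: "0 \<le> u" "u \<le> 1"
    define x where "x = (1 - u) * L + u * \<beta>"
    have "x = L + u * (\<beta> - L)" "x = \<beta> - (1 - u) * (\<beta> - L)"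
      by (simp_all add: x_def algebra_simps)
    moreover have "0 \<le> u * (\<beta> - L)" "0 \<le> (1 - u) * (\<beta> - L)" using u L1 by simp_all
    ultimately have x: "L \<le> x" "x \<le> \<beta>" by linarith+
    have "(beta_map x ^^ Suc n) 1 = ?f x"
      by (rule funpow_beta_map_eq_branch) (use \<beta> x L1 nonneg in auto)
    also have "\<dots> \<le> (1 - u) * ?f L + u * ?f \<beta>"
      unfolding x_def by (rule branch_convex) (use L1 u nonneg in auto)
    also have "\<dots> \<le> u"
      using fL lt1 u mult_left_le[of "?f \<beta>" u] by simp
    finally show "(beta_map ((1 - u) * L + u * \<beta>) ^^ Suc n) 1 \<le> u"
      unfolding x_def .
  qed
qed

section \<open>A density criterion for null sets\<close>

text \<open>Take an open \<open>G\<close> containing \<open>S\<close> with measure at most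
  \<open>e\<close> larger. Vitali covering selects disjoint low-density intervals inside
  \<open>G\<close> that cover almost all of \<open>S\<close>; summing gives
  \<open>|S| \<le> \<kappa> * |G|\<close>, and \<open>e\<close> tends to 0.\<close>

lemma lmeasurable_negligible_if_low_density:
  fixes S :: "real set"
  assumes S: "S \<in> lmeasurable" and \<kappa>: "0 \<le> \<kappa>" "\<kappa> < 1"
    and dens: "\<And>x d. x \<in> S \<Longrightarrow> 0 < d \<Longrightarrow> \<exists>u v. u < v \<and> v - u < d \<and> x \<in> {u..v} \<and>
      emeasure lebesgue (S \<inter> {u..v}) \<le> ennreal \<kappa> * emeasure lebesgue {u..v}"
  shows "negligible S"
proof -
  have bound: "measure lebesgue S \<le> \<kappa> * (measure lebesgue S + e)" if "e > 0" for e
  proof -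
    obtain G where G: "open G" "S \<subseteq> G" and diff: "G - S \<in> lmeasurable"
      "emeasure lebesgue (G - S) < ennreal e"
      using sets_lebesgue_outer_open[OF fmeasurableD[OF S] \<open>e > 0\<close>] by blast
    have "G = S \<union> (G - S)" using G(2) by blast
    then have G_meas: "G \<in> lmeasurable" using S diff(1) by (metis fmeasurable.Un)
    have "measure lebesgue (G - S) < e"
      using diff \<open>e > 0\<close> by (simp add: emeasure_eq_measure2 ennreal_less_iff)
    then have G_le: "measure lebesgue G \<le> measure lebesgue S + e"
      using measure_Un_le[of S lebesgue "G - S"] S diff(1) \<open>G = S \<union> (G - S)\<close>
      by (simp add: fmeasurableD)
    define K where "K = {(u, v). u < v \<and> {u..v} \<subseteq> G \<and>
      emeasure lebesgue (S \<inter> {u..v}) \<le> ennreal \<kappa> * emeasure lebesgue {u..v}}"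
    \<comment> \<open>The intervals are rewritten as balls for the covering theorem. A covered point
      need not be the centre, so it may be an endpoint.\<close>
    define mid where "mid = (\<lambda>(u, v). (u + v) / 2 :: real)"
    define rad where "rad = (\<lambda>(u, v). (v - u) / 2 :: real)"
    define J where "J = (\<lambda>i :: real \<times> real. {fst i..snd i})"
    have J: "cball (mid i) (rad i) = J i" for i
      by (auto simp: J_def mid_def rad_def cball_eq_atLeastAtMost field_simps split: prod.split)
    obtain C where C: "countable C" "C \<subseteq> K"
      "pairwise (\<lambda>i j. disjnt (cball (mid i) (rad i)) (cball (mid j) (rad j))) C"
      "negligible (S - (\<Union>i\<in>C. cball (mid i) (rad i)))"
    proof (rule Vitali_covering_theorem_cballs[of K rad S mid])
      show "0 < rad i" if "i \<in> K" for i using that by (auto simp: K_def rad_def)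
      show "\<exists>i. i \<in> K \<and> x \<in> cball (mid i) (rad i) \<and> rad i < d" if x: "x \<in> S" and d: "0 < d" for x d
      proof -
        obtain \<rho> where \<rho>: "\<rho> > 0" "ball x \<rho> \<subseteq> G"
          using G(1,2) x by (meson open_contains_ball subsetD)
        obtain u v where uv: "u < v" "v - u < min d \<rho>" "x \<in> {u..v}"
          "emeasure lebesgue (S \<inter> {u..v}) \<le> ennreal \<kappa> * emeasure lebesgue {u..v}"
          using dens[OF x, of "min d \<rho>"] d \<rho> by auto
        have "{u..v} \<subseteq> ball x \<rho>" using uv by (auto simp: dist_real_def)
        then have "(u, v) \<in> K" using uv \<rho> by (auto simp: K_def)
        moreover have "x \<in> cball (mid (u, v)) (rad (u, v))" using uv unfolding J by (simp add: J_def)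
        moreover have "rad (u, v) < d" using uv by (simp add: rad_def)
        ultimately show ?thesis by blast
      qed
    qed
    have disj: "disjoint_family_on J C"
      using C(3) unfolding J pairwise_def disjoint_family_on_def disjnt_def by blast
    have J_sets: "J i \<in> sets lebesgue" for i by (simp add: J_def)
    have S_sets: "S \<in> sets lebesgue" using S by (rule fmeasurableD)
    have U_sets: "(\<Union>i\<in>C. J i) \<in> sets lebesgue"
      using J_sets C(1) by (intro sets.countable_UN') auto
    have "emeasure lebesgue S =
        emeasure lebesgue ((\<Union>i\<in>C. S \<inter> J i) \<union> (S - (\<Union>i\<in>C. J i)))"
      by (rule arg_cong[where f = "emeasure lebesgue"]) blast
    also have "\<dots> = emeasure lebesgue (\<Union>i\<in>C. S \<inter> J i)"
    proof (rule emeasure_Un_null_set)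
      show "(\<Union>i\<in>C. S \<inter> J i) \<in> sets lebesgue"
        using sets.Int[OF S_sets U_sets] unfolding Int_UN_distrib .
      show "S - (\<Union>i\<in>C. J i) \<in> null_sets lebesgue"
        using C(4) unfolding J negligible_iff_null_sets .
    qed
    also have "\<dots> = (\<integral>\<^sup>+ i. emeasure lebesgue (S \<inter> J i) \<partial>count_space C)"
    proof (rule emeasure_UN_countable)
      show "disjoint_family_on (\<lambda>i. S \<inter> J i) C"
        using disj unfolding disjoint_family_on_def by blast
    qed (intro sets.Int S_sets J_sets C(1))+
    also have "\<dots> \<le> (\<integral>\<^sup>+ i. ennreal \<kappa> * emeasure lebesgue (J i) \<partial>count_space C)"
      using C(2) by (intro nn_integral_mono) (auto simp: K_def J_def)
    also have "\<dots> = ennreal \<kappa> * (\<integral>\<^sup>+ i. emeasure lebesgue (J i) \<partial>count_space C)"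
      by (intro nn_integral_cmult) simp
    also have "(\<integral>\<^sup>+ i. emeasure lebesgue (J i) \<partial>count_space C) = emeasure lebesgue (\<Union>i\<in>C. J i)"
      using J_sets C(1) disj by (intro emeasure_UN_countable[symmetric]) auto
    also have "ennreal \<kappa> * emeasure lebesgue (\<Union>i\<in>C. J i) \<le> ennreal \<kappa> * emeasure lebesgue G"
    proof (intro mult_left_mono emeasure_mono)
      have "J i \<subseteq> G" if "i \<in> K" for i using that by (cases i) (simp add: K_def J_def)
      then show "(\<Union>i\<in>C. J i) \<subseteq> G" using C(2) by blast
    qed (use G_meas in \<open>auto simp: fmeasurableD\<close>)
    finally have "emeasure lebesgue S \<le> ennreal \<kappa> * emeasure lebesgue G" .
    then have "measure lebesgue S \<le> \<kappa> * measure lebesgue G"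
      using S G_meas \<kappa> by (simp add: emeasure_eq_measure2 flip: ennreal_mult)
    also have "\<dots> \<le> \<kappa> * (measure lebesgue S + e)"
      using G_le \<kappa> by (intro mult_left_mono) auto
    finally show ?thesis .
  qed
  have "measure lebesgue S \<le> \<kappa> * measure lebesgue S"
  proof (rule field_le_epsilon)
    fix e :: real assume "e > 0"
    then have "\<kappa> * e \<le> e" using \<kappa> by (simp add: mult_left_le_one_le)
    then show "measure lebesgue S \<le> \<kappa> * measure lebesgue S + e"
      using bound[OF \<open>e > 0\<close>] by (simp add: algebra_simps)
  qed
  then have "(1 - \<kappa>) * measure lebesgue S \<le> 0" by (simp add: algebra_simps)
  then have "measure lebesgue S = 0"
    using \<kappa> measure_nonneg[of lebesgue S] by (simp add: mult_le_0_iff)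
  then show ?thesis using S negligible_iff_measure by blast
qed

lemma negligible_if_low_density:
  fixes S :: "real set"
  assumes S: "S \<in> sets lebesgue" and \<kappa>: "0 \<le> \<kappa>" "\<kappa> < 1"
    and dens: "\<And>x d. x \<in> S \<Longrightarrow> 0 < d \<Longrightarrow> \<exists>u v. u < v \<and> v - u < d \<and> x \<in> {u..v} \<and>
      emeasure lebesgue (S \<inter> {u..v}) \<le> ennreal \<kappa> * emeasure lebesgue {u..v}"
  shows "negligible S"
  unfolding negligible_on_intervals[of S]
proof (intro allI lmeasurable_negligible_if_low_density[OF _ \<kappa>])
  fix a b :: real
  show "S \<inter> cbox a b \<in> lmeasurable"
    using S by (intro fmeasurableI2[OF lmeasurable_cbox]) auto
  fix x d :: real
  assume "x \<in> S \<inter> cbox a b" "0 < d"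
  then obtain u v where uv: "u < v" "v - u < d" "x \<in> {u..v}"
    "emeasure lebesgue (S \<inter> {u..v}) \<le> ennreal \<kappa> * emeasure lebesgue {u..v}"
    using dens by blast
  have "emeasure lebesgue (S \<inter> cbox a b \<inter> {u..v}) \<le> emeasure lebesgue (S \<inter> {u..v})"
    using S by (intro emeasure_mono) auto
  then show "\<exists>u v. u < v \<and> v - u < d \<and> x \<in> {u..v} \<and>
      emeasure lebesgue (S \<inter> cbox a b \<inter> {u..v}) \<le> ennreal \<kappa> * emeasure lebesgue {u..v}"
    using uv by (meson order_trans)
qed

section \<open>Parameters for which the orbit of 1 stays away from 0\<close>

lemma measurable_orbit_one: "(\<lambda>\<beta>. (beta_map \<beta> ^^ n) 1) \<in> borel_measurable borel"
  by (induction n) (auto simp: beta_map_def)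

lemma negligible_orbit_one_bounded_below:
  assumes \<delta>: "0 < \<delta>"
  shows "negligible {\<beta>. \<beta> > 1 \<and> (\<forall>n. \<delta> \<le> (beta_map \<beta> ^^ n) 1)}" (is "negligible ?A")
proof (cases "\<delta> \<le> 1")
  case False
  then have "?A = {}" by (auto intro!: exI[of _ 0])
  then show ?thesis by (metis negligible_empty)
next
  case True
  note measurable_orbit_one[measurable]
  have "?A \<in> sets borel" by measurable
  then have A: "?A \<in> sets lebesgue" by simp
  show ?thesis
  proof (rule negligible_if_low_density[OF A, of "1 - \<delta>"])
    fix \<beta> d :: real
    assume "\<beta> \<in> ?A" and d: "0 < d"
    then have \<beta>: "\<beta> > 1" and ge: "\<And>n. \<delta> \<le> (beta_map \<beta> ^^ n) 1" by auto
    \<comment> \<open>With this \<open>n\<close>, the interval \<open>{L..\<beta>}\<close> is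
      shorter than \<open>\<beta> ^ -n < d\<close>.\<close>
    obtain n where "1 / d < \<beta> ^ n" using real_arch_pow[OF \<beta>] by blast
    then have n: "1 < \<beta> ^ n * d" using d by (simp add: field_simps)
    have "0 < (beta_map \<beta> ^^ Suc n) 1" using ge[of "Suc n"] \<delta> by linarith
    then obtain L where L: "1 \<le> L" "L < \<beta>" "\<beta> ^ n * (\<beta> - L) < 1"
      and small: "\<And>u. 0 \<le> u \<Longrightarrow> u \<le> 1 \<Longrightarrow> (beta_map ((1 - u) * L + u * \<beta>) ^^ Suc n) 1 \<le> u"
      using small_orbit_one_left_of[OF \<beta>] by metis
    have "\<beta> ^ n * (\<beta> - L) < \<beta> ^ n * d" using n L by linarith
    then have "\<beta> - L < d" using \<beta> by simp
    \<comment> \<open>At relative position \<open>u\<close> in \<open>{L..\<beta>}\<close> the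
      iterate is at most \<open>u\<close>, so membership in the set forces
      \<open>u \<ge> \<delta>\<close>.\<close>
    have "?A \<inter> {L..\<beta>} \<subseteq> {L + \<delta> * (\<beta> - L)..\<beta>}"
    proof
      fix x assume x: "x \<in> ?A \<inter> {L..\<beta>}"
      define u where "u = (x - L) / (\<beta> - L)"
      have u: "0 \<le> u" "u \<le> 1" using x L by (auto simp: u_def)
      have ux: "u * (\<beta> - L) = x - L" using L by (simp add: u_def)
      then have "(1 - u) * L + u * \<beta> = x" by (simp add: algebra_simps)
      then have "(beta_map x ^^ Suc n) 1 \<le> u" using small[OF u] by simp
      moreover have "\<delta> \<le> (beta_map x ^^ Suc n) 1" using x by blast
      ultimately have "\<delta> * (\<beta> - L) \<le> u * (\<beta> - L)" using L by simp
      then show "x \<in> {L + \<delta> * (\<beta> - L)..\<beta>}" using x ux by auto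
    qed
    then have "emeasure lebesgue (?A \<inter> {L..\<beta>}) \<le> emeasure lebesgue {L + \<delta> * (\<beta> - L)..\<beta>}"
      by (intro emeasure_mono) auto
    also have "\<dots> = ennreal ((1 - \<delta>) * (\<beta> - L))"
    proof -
      have "\<delta> * (\<beta> - L) \<le> 1 * (\<beta> - L)" using True L by (intro mult_right_mono) auto
      then have "L + \<delta> * (\<beta> - L) \<le> \<beta>" by (simp only: mult_1 le_diff_eq add.commute)
      then show ?thesis by (simp add: algebra_simps)
    qed
    also have "\<dots> = ennreal (1 - \<delta>) * emeasure lebesgue {L..\<beta>}"
      using True L by (simp add: ennreal_mult)
    finally show "\<exists>u v. u < v \<and> v - u < d \<and> \<beta> \<in> {u..v} \<and>
        emeasure lebesgue (?A \<inter> {u..v}) \<le> ennreal (1 - \<delta>) * emeasure lebesgue {u..v}"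
      using L \<open>\<beta> - L < d\<close> by (intro exI[of _ L] exI[of _ \<beta>]) auto
  qed (use \<delta> True in auto)
qed

theorem theorem6:
  shows "AE \<beta> in lebesgue. \<beta> > 1 \<longrightarrow>
           locally_eventually_onto {0..<1} (beta_map \<beta>) \<and>
           positively_expansive {0..<1} (beta_map \<beta>) \<and>
           \<not> specification_property {0..<1} (beta_map \<beta>)"
proof -
  let ?Z = "{\<beta>. \<exists>n. (beta_map \<beta> ^^ n) 1 = 0}"
  \<comment> \<open>A positive lower bound of the orbit may be taken of the form
    \<open>1 / (m + 1)\<close>, which leaves a countable union of null sets.\<close>
  let ?A = "\<lambda>m. {\<beta>. \<beta> > 1 \<and> (\<forall>n. 1 / real (Suc m) \<le> (beta_map \<beta> ^^ n) 1)}"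
  have "negligible (?Z \<union> (\<Union>m. ?A m))"
  proof (intro negligible_Un negligible_countable_Union)
    show "negligible ?Z"
      using countable_imp_null_set_lborel[OF countable_zeros_orbit_one]
      by (simp add: negligible_iff_null_sets null_sets_completionI)
  qed (auto intro: negligible_orbit_one_bounded_below)
  then have "AE \<beta> in lebesgue. \<beta> \<notin> ?Z \<union> (\<Union>m. ?A m)"
    by (intro AE_not_in) (simp add: negligible_iff_null_sets)
  then show ?thesis
  proof (rule AE_mp, intro AE_I2 impI conjI)
    fix \<beta> :: real
    assume notin: "\<beta> \<notin> ?Z \<union> (\<Union>m. ?A m)" and \<beta>: "\<beta> > 1"
    show "locally_eventually_onto {0..<1} (beta_map \<beta>)"
      using \<beta> by (rule beta_map_locally_eventually_onto)
    show "positively_expansive {0..<1} (beta_map \<beta>)"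
      using \<beta> by (rule beta_map_positively_expansive)
    show "\<not> specification_property {0..<1} (beta_map \<beta>)"
    proof (rule beta_map_not_specification[OF \<beta>])
      show "(beta_map \<beta> ^^ n) 1 > 0" for n
        using notin funpow_beta_map_le[of \<beta> 1 n] \<beta> by (simp add: order_less_le)
      fix \<delta> :: real assume "\<delta> > 0"
      then obtain m where m: "1 / real (Suc m) < \<delta>" using nat_approx_posE by metis
      obtain n where "(beta_map \<beta> ^^ n) 1 < 1 / real (Suc m)"
        using notin \<beta> by (auto simp: not_le simp del: of_nat_Suc)
      then show "\<exists>n. (beta_map \<beta> ^^ n) 1 < \<delta>" using m less_trans by blast
    qed
  qed
qed

end
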